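(* Let $\mathcal{T}=(\mathcal{V},\mathcal{E})$ be a tree with $\mathcal{V}=\{1,\ldots,d\}$, let $\boldsymbol{q}=(q_v,\,v\in\mathcal{V})\in(0,1)^d$ and $\boldsymbol{\alpha}=(\alpha_e,\,e\in\mathcal{E})\in\Lambda(\boldsymbol{q})$, let $\boldsymbol{J}=(J_v,\,v\in\mathcal{V})$ be the tree-structured Ising model on $\mathcal{T}$ mean-parameterized by $\boldsymbol{q}$ and $\boldsymbol{\alpha}$, and let $K=\sum_{v\in\mathcal{V}}J_v$. Let $j\in\mathcal{V}$ and root the tree at $j$. Then the ordinary generating function of expected allocations of $J_j$ with respect to $K$ is $$\mathcal{P}_K^{[j]}(t)=q_j\,t\prod_{i\in\mathrm{ch}(j)}\xi_i^{\mathcal{T}_j}(\boldsymbol{t}_{i\mathrm{dsc}(i)}),\quad t\in[-1,1],$$ where every component of $\boldsymbol{t}$ is equal to $t$, i.e. $\boldsymbol{t}=(t,\ldots,t)$.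
   Context: The ordinary generating function of expected allocations (OGFEA) of $J_j$ with respect to $K$ is $\mathcal{P}_K^{[j]}(t)=\sum_{k=0}^{\infty}t^k\,\mathrm{E}[J_j\mathbf{1}_{\{K=k\}}]$, $t\in[-1,1]$. Tree $\mathcal{T}_j$ rooted at $j$: the descendants $\mathrm{dsc}(u)$ of $u$ are the vertices $w\neq u$ such that $u$ lies on the path from $w$ to the root $j$; the children $\mathrm{ch}(u)$ are the descendants of $u$ that are neighbors of $u$; the parent $\mathrm{pa}(u)$ of $u\neq j$ is its unique neighbor that is not a child. $\boldsymbol{t}_{v\mathrm{dsc}(v)}=(t_w,\,w\in\{v\}\cup\mathrm{dsc}(v))$ for $\boldsymbol{t}\in[-1,1]^d$. With $\sigma_{(u,v)}=\sqrt{q_uq_v(1-q_u)(1-q_v)}$, the functions $\zeta_v^{\mathcal{T}_j},\xi_v^{\mathcal{T}_j}$, $v\in\mathrm{dsc}(j)$, are defined recursively (empty products equal $1$) by $$\zeta_v^{\mathcal{T}_j}(\boldsymbol{t}_{v\mathrm{dsc}(v)})=\left(1-q_v+\tfrac{\alpha_{(\mathrm{pa}(v),v)}\sigma_{(\mathrm{pa}(v),v)}}{1-q_{\mathrm{pa}(v)}}\right)\prod_{i\in\mathrm{ch}(v)}\zeta_i^{\mathcal{T}_j}(\boldsymbol{t}_{i\mathrm{dsc}(i)})+\left(q_v-\tfrac{\alpha_{(\mathrm{pa}(v),v)}\sigma_{(\mathrm{pa}(v),v)}}{1-q_{\mathrm{pa}(v)}}\right)t_v\prod_{i\in\mathrm{ch}(v)}\xi_i^{\mathcal{T}_j}(\boldsymbol{t}_{i\mathrm{dsc}(i)}),$$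 $$\xi_v^{\mathcal{T}_j}(\boldsymbol{t}_{v\mathrm{dsc}(v)})=\left(1-q_v-\tfrac{\alpha_{(\mathrm{pa}(v),v)}\sigma_{(\mathrm{pa}(v),v)}}{q_{\mathrm{pa}(v)}}\right)\prod_{i\in\mathrm{ch}(v)}\zeta_i^{\mathcal{T}_j}(\boldsymbol{t}_{i\mathrm{dsc}(i)})+\left(q_v+\tfrac{\alpha_{(\mathrm{pa}(v),v)}\sigma_{(\mathrm{pa}(v),v)}}{q_{\mathrm{pa}(v)}}\right)t_v\prod_{i\in\mathrm{ch}(v)}\xi_i^{\mathcal{T}_j}(\boldsymbol{t}_{i\mathrm{dsc}(i)}).$$ $\Lambda(\boldsymbol{q})$ is the set of $\boldsymbol{\alpha}=(\alpha_e,e\in\mathcal{E})$ such that, for every edge $(u,v)\in\mathcal{E}$, $$-\min\left(\sqrt{\tfrac{q_uq_v}{(1-q_u)(1-q_v)}},\sqrt{\tfrac{(1-q_u)(1-q_v)}{q_uq_v}}\right)<\alpha_{(u,v)}<\min\left(\sqrt{\tfrac{(1-q_u)q_v}{q_u(1-q_v)}},\sqrt{\tfrac{q_u(1-q_v)}{(1-q_u)q_v}}\right).$$ Tree-structured Ising model mean-parameterized by $\boldsymbol{q},\boldsymbol{\alpha}$ on $\mathcal{T}$: the random vector $\boldsymbol{J}$ on $\{0,1\}^d$ whose pmf has the form $p_{\boldsymbol{J}}(\boldsymbol{x})=\exp(\sum_{v\in\mathcal{V}}\eta_vx_v+\sum_{(u,v)\in\mathcal{E}}\eta_{(u,v)}x_ux_v-A(\boldsymbol{\eta}))$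 for real parameters $\boldsymbol{\eta}$ and normalizing constant $A(\boldsymbol{\eta})$, with $\mathrm{E}[J_v]=q_v$ for all $v\in\mathcal{V}$ and Pearson correlation $\mathrm{Corr}(J_u,J_v)=\alpha_{(u,v)}$ for all edges $(u,v)\in\mathcal{E}$. Equivalently, for any choice of root $r\in\mathcal{V}$ (with parents taken with respect to $r$), with $p_v(x)=q_v^{x}(1-q_v)^{1-x}$, $$p_{\boldsymbol{J}}(\boldsymbol{x})=p_r(x_r)\prod_{v\neq r}\frac{p_v(x_v)\,p_{\mathrm{pa}(v)}(x_{\mathrm{pa}(v)})+\alpha_{(\mathrm{pa}(v),v)}(-1)^{x_v+x_{\mathrm{pa}(v)}}\sigma_{(\mathrm{pa}(v),v)}}{p_{\mathrm{pa}(v)}(x_{\mathrm{pa}(v)})},\quad\boldsymbol{x}\in\{0,1\}^d.$$ *)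

theory Defs
  imports "HOL-Probability.Probability" "Graph_Theory.Pair_Digraph" "Graph_Theory.Digraph_Component"
begin

section \<open>Trees\<close>

text \<open>
  Undirected graphs are symmetric loop-free digraphs (\<^locale>\<open>pair_graph\<close>). Since there u, v, u counts
  as a cycle, the notions of forest and tree from \<^theory>\<open>Graph_Theory.Digraph_Component\<close> do not
  describe undirected trees; a cycle of an undirected graph has at least three edges.
\<close>

locale undirected_tree = pair_graph G for G :: "'v pair_pre_digraph" +
  assumes tree_connected: "Digraph_Component.connected (with_proj G)"
    and tree_acyclic: "\<not> (\<exists>p. cycle p \<and> 3 \<le> length p)"

definition edges :: "'v pair_pre_digraph \<Rightarrow> 'v set set" where
  "edges G = {{u, v} | u v. (u, v) \<in> parcs G}"

context undirected_tree
begin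

lemma awalk_reverse:
  assumes "awalk u p v"
  shows "\<exists>p'. awalk v p' u \<and> set (pawalk_verts v p') = set (pawalk_verts u p)"
  using assms
proof (induction p arbitrary: u)
  case Nil
  then show ?case by (auto simp: awalk_Nil_iff intro!: exI[of _ "[]"])
next
  case (Cons e p)
  obtain a where e: "e = (u, a)" "(u, a) \<in> parcs G" and p: "awalk a p v"
    using Cons.prems by (cases e) (auto simp: awalk_Cons_iff)
  obtain p' where p': "awalk v p' a" "set (pawalk_verts v p') = set (pawalk_verts a p)"
    using Cons.IH[OF p] by blast
  have "(a, u) \<in> parcs G"
    using e(2) pair_sym_arcs by (auto simp: symmetric_def dest: symD)
  then have au: "awalk a [(a, u)] u"
    by (auto simp: awalk_Cons_iff awalk_Nil_iff dest: wellformed')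
  have "awalk v (p' @ [(a, u)]) u"
    using awalk_appendI[OF p'(1) au] .
  moreover have "set (pawalk_verts v (p' @ [(a, u)])) = set (pawalk_verts u (e # p))"
    using set_awalk_verts_append[OF p'(1) au] p'(2) hd_in_awalk_verts(1)[OF p] e by auto
  ultimately show ?case by blast
qed

lemma awalk_apath_avoiding:
  assumes "awalk u p v" and "w \<notin> set (pawalk_verts u p)"
  shows "\<exists>r. apath u r v \<and> w \<notin> set (pawalk_verts u r)"
proof -
  have "apath u (awalk_to_apath p) v" "set (awalk_to_apath p) \<subseteq> set p"
    using assms apath_awalk_to_apath awalk_to_apath_subset by auto
  then show ?thesis
    using assms set_awalk_verts[OF assms(1)] set_awalk_verts[OF awalkI_apath, of u _ v]
    by (intro exI[of _ "awalk_to_apath p"]) auto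
qed

lemma apath_unique:
  assumes "apath u p v" "apath u q v"
  shows "p = q"
  using assms
proof (induction p arbitrary: u q)
  case Nil
  then show ?case using apath_nonempty_ends by (auto simp: apath_Nil_iff)
next
  case (Cons e p)
  then have "q \<noteq> []"
    using apath_nonempty_ends by (auto simp: apath_Nil_iff)
  then obtain f q' where q: "q = f # q'" by (cases q) auto
  obtain a where e: "e = (u, a)" "(u, a) \<in> parcs G" and p: "apath a p v" "u \<notin> set (pawalk_verts a p)"
    using Cons.prems(1) by (cases e) (auto simp: apath_Cons_iff)
  obtain b where f: "f = (u, b)" "(u, b) \<in> parcs G" and q': "apath b q' v" "u \<notin> set (pawalk_verts b q')"
    using Cons.prems(2) q by (cases f) (auto simp: apath_Cons_iff)
  show ?case
  proof (cases "a = b")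
    case True
    then show ?thesis using Cons.IH[OF p(1)] q' q e f by auto
  next
    case False
    obtain s where s: "awalk v s b" "set (pawalk_verts v s) = set (pawalk_verts b q')"
      using awalk_reverse q' awalkI_apath by blast
    have "awalk a (p @ s) b" "u \<notin> set (pawalk_verts a (p @ s))"
      using awalk_appendI[OF awalkI_apath[OF p(1)] s(1)]
        set_awalk_verts_append[OF awalkI_apath[OF p(1)] s(1)] p q' s by auto
    then obtain r where r: "apath a r b" "u \<notin> set (pawalk_verts a r)"
      using awalk_apath_avoiding by blast
    have "r \<noteq> []" using r False by (auto simp: apath_Nil_iff)
    have "(b, u) \<in> parcs G"
      using f(2) pair_sym_arcs by (auto simp: symmetric_def dest: symD)
    then have bu: "awalk b [(b, u)] u"
      by (auto simp: awalk_Cons_iff awalk_Nil_iff dest: wellformed')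
    have w: "awalk a (r @ [(b, u)]) u"
      using awalk_appendI[OF awalkI_apath[OF r(1)] bu] .
    have "pawalk_verts a (r @ [(b, u)]) = pawalk_verts a r @ [u]"
      using awalk_verts_append[OF w] awlast_of_awalk[OF awalkI_apath[OF r(1)]] by simp
    then have "cycle ((u, a) # r @ [(b, u)])"
      unfolding cycle_def using w r e
      by (intro exI[of _ u]) (auto simp: awalk_Cons_iff apath_def)
    moreover have "3 \<le> length ((u, a) # r @ [(b, u)])"
      using \<open>r \<noteq> []\<close> by (cases r) auto
    ultimately show ?thesis using tree_acyclic by blast
  qed
qed

end

section \<open>Rooted trees\<close>

locale rooted_tree = undirected_tree G for G :: "'v pair_pre_digraph" +
  fixes j :: 'v
  assumes root_in_verts: "j \<in> pverts G"
begin

definition dsc :: "'v \<Rightarrow> 'v set" where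
  "dsc u = {w. w \<noteq> u \<and> (\<exists>p. apath w p j \<and> u \<in> set (pawalk_verts w p))}"

definition ch :: "'v \<Rightarrow> 'v set" where
  "ch u = {w \<in> dsc u. (u, w) \<in> parcs G}"

definition pa :: "'v \<Rightarrow> 'v" where
  "pa u = (THE w. (u, w) \<in> parcs G \<and> w \<notin> ch u)"

lemma finite_dsc: "finite (dsc u)"
proof -
  have "dsc u \<subseteq> pverts G"
    by (auto simp: dsc_def dest!: awalkI_apath awalk_hd_in_verts)
  then show ?thesis using pair_finite_verts finite_subset by blast
qed

lemma apath_suffix:
  assumes "apath w p j" "u \<in> set (pawalk_verts w p)"
  obtains p1 p2 where "p = p1 @ p2" "awalk w p1 u" "apath u p2 j"
    "set (pawalk_verts u p2) \<subseteq> set (pawalk_verts w p)"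
proof -
  obtain p1 p2 where p: "p = p1 @ p2" "awalk w p1 u" "awalk u p2 j"
    using awalk_decomp[OF awalkI_apath[OF assms(1)] assms(2)] by blast
  then have "apath u p2 j"
    using assms(1) awlast_of_awalk[OF p(2)] by (auto simp: apath_append_iff)
  then show thesis using that p set_awalk_verts_append[OF p(2,3)] by auto
qed

lemma dsc_child_psubset:
  assumes "i \<in> ch v"
  shows "dsc i \<subset> dsc v"
proof -
  have "i \<in> dsc v" using assms by (simp add: ch_def)
  then obtain p where iv: "i \<noteq> v" and p: "apath i p j" "v \<in> set (pawalk_verts i p)"
    by (auto simp: dsc_def)
  have "dsc i \<subseteq> dsc v"
  proof
    fix w assume "w \<in> dsc i"
    then obtain r where wi: "w \<noteq> i" and r: "apath w r j" "i \<in> set (pawalk_verts w r)"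
      by (auto simp: dsc_def)
    obtain r1 r2 where r12: "r = r1 @ r2" "awalk w r1 i" "apath i r2 j"
      "set (pawalk_verts i r2) \<subseteq> set (pawalk_verts w r)"
      using apath_suffix[OF r] by metis
    have r2: "r2 = p" using apath_unique r12(3) p(1) by blast
    have "w \<noteq> v"
    proof
      assume "w = v"
      obtain p1 p2 where p12: "p = p1 @ p2" "awalk i p1 v" "apath v p2 j"
        using apath_suffix[OF p] by metis
      have "p2 = r" using apath_unique p12(3) r(1) \<open>w = v\<close> by blast
      then have "r1 = []" using p12(1) r12(1) r2 by simp
      then show False using r12(2) wi by (auto simp: awalk_Nil_iff)
    qed
    then show "w \<in> dsc v" using r r12 r2 p by (auto simp: dsc_def)
  qed
  moreover have "i \<notin> dsc i" by (simp add: dsc_def)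
  ultimately show ?thesis using \<open>i \<in> dsc v\<close> by blast
qed

end

section \<open>The recursive functions\<close>

definition sigma :: "('v \<Rightarrow> real) \<Rightarrow> 'v \<Rightarrow> 'v \<Rightarrow> real" where
  "sigma q u v = sqrt (q u * q v * (1 - q u) * (1 - q v))"

context rooted_tree
begin

text \<open>
  Edge-indexed families such as \<open>\<alpha>\<close> are functions on unordered pairs. The vector \<open>t\<close> is a
  function on all vertices; the values at \<open>v\<close> only depend on its restriction to
  \<open>{v} \<union> dsc v\<close>. The functions are meant for \<open>v \<in> dsc j\<close>; their values at other vertices
  have no significance.
\<close>

function zeta xi :: "('v \<Rightarrow> real) \<Rightarrow> ('v set \<Rightarrow> real) \<Rightarrow> ('v \<Rightarrow> real) \<Rightarrow> 'v \<Rightarrow> real" where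
  "zeta q \<alpha> t v =
     (1 - q v + \<alpha> {pa v, v} * sigma q (pa v) v / (1 - q (pa v))) * (\<Prod>i\<in>ch v. zeta q \<alpha> t i)
     + (q v - \<alpha> {pa v, v} * sigma q (pa v) v / (1 - q (pa v))) * t v * (\<Prod>i\<in>ch v. xi q \<alpha> t i)"
| "xi q \<alpha> t v =
     (1 - q v - \<alpha> {pa v, v} * sigma q (pa v) v / q (pa v)) * (\<Prod>i\<in>ch v. zeta q \<alpha> t i)
     + (q v + \<alpha> {pa v, v} * sigma q (pa v) v / q (pa v)) * t v * (\<Prod>i\<in>ch v. xi q \<alpha> t i)"
  by pat_completeness auto
termination
  by (relation "Wellfounded.measure (\<lambda>x. case x of Inl (q, \<alpha>, t, v) \<Rightarrow> card (dsc v) | Inr (q, \<alpha>, t, v) \<Rightarrow> card (dsc v))")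
     (auto intro!: psubset_card_mono finite_dsc dsc_child_psubset)

declare zeta.simps [simp del] xi.simps [simp del]

end

section \<open>The Ising model and expected allocations\<close>

definition Lambda :: "'v pair_pre_digraph \<Rightarrow> ('v \<Rightarrow> real) \<Rightarrow> ('v set \<Rightarrow> real) set" where
  "Lambda G q = {\<alpha>. \<forall>(u, v) \<in> parcs G.
     - min (sqrt (q u * q v / ((1 - q u) * (1 - q v)))) (sqrt ((1 - q u) * (1 - q v) / (q u * q v)))
       < \<alpha> {u, v} \<and>
     \<alpha> {u, v}
       < min (sqrt ((1 - q u) * q v / (q u * (1 - q v)))) (sqrt (q u * (1 - q v) / ((1 - q u) * q v)))}"

text \<open>For an edge \<open>e = {u, v}\<close>, the product over \<open>e\<close> is \<open>x u * x v\<close>.\<close>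

definition ising_exponent ::
  "'v pair_pre_digraph \<Rightarrow> ('v \<Rightarrow> real) \<Rightarrow> ('v set \<Rightarrow> real) \<Rightarrow> ('v \<Rightarrow> nat) \<Rightarrow> real" where
  "ising_exponent G \<eta> \<eta>' x =
     (\<Sum>v\<in>pverts G. \<eta> v * real (x v)) + (\<Sum>e\<in>edges G. \<eta>' e * (\<Prod>v\<in>e. real (x v)))"

definition log_partition ::
  "'v pair_pre_digraph \<Rightarrow> ('v \<Rightarrow> real) \<Rightarrow> ('v set \<Rightarrow> real) \<Rightarrow> real" where
  "log_partition G \<eta> \<eta>' = ln (\<Sum>x\<in>pverts G \<rightarrow>\<^sub>E {0, 1}. exp (ising_exponent G \<eta> \<eta>' x))"

context prob_space
begin

definition correlation :: "('a \<Rightarrow> real) \<Rightarrow> ('a \<Rightarrow> real) \<Rightarrow> real" where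
  "correlation X Y =
     expectation (\<lambda>\<omega>. (X \<omega> - expectation X) * (Y \<omega> - expectation Y)) / sqrt (variance X * variance Y)"

definition ising_model ::
  "'v pair_pre_digraph \<Rightarrow> ('v \<Rightarrow> real) \<Rightarrow> ('v set \<Rightarrow> real) \<Rightarrow> ('v \<Rightarrow> 'a \<Rightarrow> nat) \<Rightarrow> bool" where
  "ising_model G q \<alpha> J \<longleftrightarrow>
     (\<forall>v\<in>pverts G. random_variable (count_space {0, 1}) (J v)) \<and>
     (\<exists>\<eta> \<eta>'. \<forall>x \<in> pverts G \<rightarrow>\<^sub>E {0, 1}.
        prob {\<omega> \<in> space M. \<forall>v\<in>pverts G. J v \<omega> = x v}
          = exp (ising_exponent G \<eta> \<eta>' x - log_partition G \<eta> \<eta>')) \<and>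
     (\<forall>v\<in>pverts G. expectation (\<lambda>\<omega>. real (J v \<omega>)) = q v) \<and>
     (\<forall>(u, v)\<in>parcs G. correlation (\<lambda>\<omega>. real (J u \<omega>)) (\<lambda>\<omega>. real (J v \<omega>)) = \<alpha> {u, v})"

definition ogfea :: "('a \<Rightarrow> real) \<Rightarrow> ('a \<Rightarrow> nat) \<Rightarrow> real \<Rightarrow> real" where
  "ogfea X K t = (\<Sum>k. t ^ k * expectation (\<lambda>\<omega>. X \<omega> * indicator {\<omega> \<in> space M. K \<omega> = k} \<omega>))"

end

end

theory Submission
  imports Defs
begin

text \<open>
  Why the formula holds. Since K is bounded, the generating function of expected allocations is the
  expectation of \<open>J j * t ^ K\<close>, that is, of \<open>J j\<close> times the product of all \<open>t ^ J v\<close>. Written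
  out with the Ising mass function, it is a sum over configurations with a one at the root, and the
  weight of a configuration is a product of factors that involve a vertex and its parent only.

  Such sums are evaluated along the tree. With the value at a vertex fixed, the branches at its
  children are independent (\<open>below_eq\<close>), and the sum over a branch splits according to the value at
  its top vertex (\<open>branch_eq\<close>). Dividing the resulting partition functions by their values at
  \<open>t = 1\<close> gives a recursion whose coefficients are the conditional probabilities of a vertex given
  its parent. The functions zeta and xi satisfy the same recursion (\<open>branch_eq_zeta_xi\<close>).

  The conditional probabilities have to be read off from the means and correlations, because the
  natural parameters of the model are unknown. Cutting an edge shows that the joint mass of its two
  endpoints is a function of the upper value times a contribution of the lower branch
  (\<open>sum_weight_edge\<close>), so the share of a value in the branch partition function is its
  conditional probability at the lower vertex; and the law of a pair of variables with values 0 and 1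
  is determined by the two means and the correlation (\<open>transition_from_moments\<close>). The normalisation at the root is the mean of
  \<open>J j\<close>, which produces the factor \<open>q j\<close>.
\<close>

section \<open>Sums over configurations\<close>

lemma sum_PiE_insert:
  assumes "a \<notin> A"
  shows "(\<Sum>x\<in>PiE (insert a A) F. h x) = (\<Sum>b\<in>F a. \<Sum>x\<in>PiE A F. h (x(a := b)))"
  unfolding PiE_insert_eq sum.reindex[OF inj_combinator[OF assms]]
  by (simp add: sum.cartesian_product case_prod_unfold comp_def)

lemma sum_PiE_Un:
  assumes "A \<inter> B = {}"
  shows "(\<Sum>x\<in>PiE (A \<union> B) F. h x) = (\<Sum>y\<in>PiE A F. \<Sum>z\<in>PiE B F. h (override_on y z B))"
proof -
  have "(\<Sum>x\<in>PiE (A \<union> B) F. h x) = (\<Sum>(y, z)\<in>PiE A F \<times> PiE B F. h (override_on y z B))"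
  proof (rule sum.reindex_bij_witness[of _ "\<lambda>(y, z). override_on y z B"
        "\<lambda>x. (restrict x A, restrict x B)"])
    fix x assume x: "x \<in> PiE (A \<union> B) F"
    show *: "(case (restrict x A, restrict x B) of (y, z) \<Rightarrow> override_on y z B) = x"
      using x by (auto simp: override_on_def PiE_iff extensional_def)
    show "(restrict x A, restrict x B) \<in> PiE A F \<times> PiE B F" using x by (auto simp: PiE_iff)
    show "(case (restrict x A, restrict x B) of (y, z) \<Rightarrow> h (override_on y z B)) = h x"
      using * by simp
  next
    fix w assume "w \<in> PiE A F \<times> PiE B F"
    then obtain y z where w: "w = (y, z)" "y \<in> PiE A F" "z \<in> PiE B F" by blast
    show "(case w of (y, z) \<Rightarrow> override_on y z B) \<in> PiE (A \<union> B) F"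
      using w by (auto simp: PiE_iff override_on_def extensional_def)
    have "restrict (override_on y z B) A = y"
      using w assms by (intro ext) (auto simp: PiE_iff override_on_def extensional_def)
    moreover have "restrict (override_on y z B) B = z"
      using w by (intro ext) (auto simp: PiE_iff override_on_def extensional_def)
    ultimately show "(restrict (case w of (y, z) \<Rightarrow> override_on y z B) A,
        restrict (case w of (y, z) \<Rightarrow> override_on y z B) B) = w"
      using w by simp
  qed
  then show ?thesis by (simp add: sum.cartesian_product)
qed

text \<open>
  The distributive law for configurations; it will be applied to the branches below a vertex, each of
  which only sees its own coordinates once the value at the vertex is fixed.
\<close>

lemma sum_PiE_prod_disjoint:
  fixes f :: "'i \<Rightarrow> ('v \<Rightarrow> 'b) \<Rightarrow> 'c :: comm_semiring_1"
  assumes "finite I"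
    and "disjoint_family_on S I"
    and "\<And>i x y. i \<in> I \<Longrightarrow> (\<And>u. u \<in> S i \<Longrightarrow> x u = y u) \<Longrightarrow> f i x = f i y"
  shows "(\<Sum>x\<in>PiE (\<Union>i\<in>I. S i) F. \<Prod>i\<in>I. f i x) = (\<Prod>i\<in>I. \<Sum>x\<in>PiE (S i) F. f i x)"
  using assms
proof (induction I rule: finite_induct)
  case empty
  then show ?case by simp
next
  case (insert k I)
  have disj: "S k \<inter> (\<Union>i\<in>I. S i) = {}"
    using insert.prems(1) insert.hyps by (fastforce simp: disjoint_family_on_def)
  have k: "f k (override_on y z (\<Union>i\<in>I. S i)) = f k y" for y z
    using disj by (intro insert.prems(2)) (auto simp: override_on_def)
  have I: "(\<Prod>i\<in>I. f i (override_on y z (\<Union>i\<in>I. S i))) = (\<Prod>i\<in>I. f i z)" for y z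
    by (intro prod.cong refl insert.prems(2)) (auto simp: override_on_def)
  have "(\<Sum>x\<in>PiE (\<Union>i\<in>insert k I. S i) F. \<Prod>i\<in>insert k I. f i x)
      = (\<Sum>y\<in>PiE (S k) F. \<Sum>z\<in>PiE (\<Union>i\<in>I. S i) F. f k y * (\<Prod>i\<in>I. f i z))"
    using insert.hyps sum_PiE_Un[OF disj, of "\<lambda>x. f k x * (\<Prod>i\<in>I. f i x)" F] by (simp add: k I)
  also have "\<dots> = (\<Sum>y\<in>PiE (S k) F. f k y) * (\<Sum>z\<in>PiE (\<Union>i\<in>I. S i) F. \<Prod>i\<in>I. f i z)"
    by (simp add: sum_product)
  also have "(\<Sum>z\<in>PiE (\<Union>i\<in>I. S i) F. \<Prod>i\<in>I. f i z) = (\<Prod>i\<in>I. \<Sum>x\<in>PiE (S i) F. f i x)"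
    using insert.prems(1) by (intro insert.IH insert.prems(2)) (auto simp: disjoint_family_on_def)
  finally show ?case using insert.hyps by simp
qed

section \<open>Parents and descendants\<close>

context rooted_tree
begin

lemma arc_sym: "(u, v) \<in> parcs G \<Longrightarrow> (v, u) \<in> parcs G"
  using pair_sym_arcs by (auto simp: symmetric_def dest: symD)

lemma apath_to_root:
  assumes "u \<in> pverts G"
  obtains p where "apath u p j"
proof -
  have "strongly_connected (with_proj G)"
    using symmetric_connected_imp_strongly_connected pair_sym_arcs tree_connected by simp
  then show thesis
    using assms root_in_verts that reachable_apath unfolding strongly_connected_def
    by (metis with_proj_simps(1))
qed

lemma dsc_in_verts: "dsc u \<subseteq> pverts G"
  by (auto simp: dsc_def dest!: awalkI_apath awalk_hd_in_verts)

lemma on_apath_iff: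
  assumes "apath u p j"
  shows "v \<in> set (pawalk_verts u p) \<longleftrightarrow> u = v \<or> u \<in> dsc v"
  using assms apath_unique hd_in_awalk_verts(1)[OF awalkI_apath[OF assms]] by (auto simp: dsc_def)

text \<open>
  The first arc of the path from u to the root leads to the parent: any other neighbour has u on
  its own path to the root, for otherwise u would have a second path.
\<close>

lemma apath_to_root_parent:
  assumes "u \<in> pverts G" "u \<noteq> j"
  obtains p where "(u, pa u) \<in> parcs G" "apath (pa u) p j" "apath u ((u, pa u) # p) j"
    "u \<notin> set (pawalk_verts (pa u) p)"
    "\<And>w. (u, w) \<in> parcs G \<Longrightarrow> w \<notin> ch u \<Longrightarrow> w = pa u"
proof -
  obtain r where r: "apath u r j" using apath_to_root assms(1) .
  then obtain w p where w: "r = (u, w) # p" "(u, w) \<in> parcs G" "apath w p j"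
    "u \<notin> set (pawalk_verts w p)"
    using assms(2) by (cases r) (auto simp: apath_Cons_iff apath_Nil_iff)
  have wu: "w \<notin> ch u"
    using on_apath_iff[OF w(3)] w(4) by (auto simp: ch_def)
  have uniq: "w' = w" if w': "(u, w') \<in> parcs G" "w' \<notin> ch u" for w'
  proof -
    obtain p' where p': "apath w' p' j"
      using apath_to_root w'(1) wellformed'(2) by blast
    have "w' \<noteq> u" using w'(1) pair_no_loops[OF w'(1)] by auto
    then have "u \<notin> set (pawalk_verts w' p')"
      using w' on_apath_iff[OF p'] by (auto simp: ch_def)
    then have "apath u ((u, w') # p') j"
      using w'(1) p' by (simp add: apath_Cons_iff)
    then show ?thesis using apath_unique r w(1) by blast
  qed
  have "pa u = w"
    unfolding pa_def using w(2) wu uniq by (intro the_equality) blast+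
  then show thesis using that w uniq r by metis
qed

lemma pa_arc: "u \<in> pverts G \<Longrightarrow> u \<noteq> j \<Longrightarrow> (u, pa u) \<in> parcs G"
  using apath_to_root_parent by metis

lemma pa_in_verts: "u \<in> pverts G \<Longrightarrow> u \<noteq> j \<Longrightarrow> pa u \<in> pverts G"
  using pa_arc wellformed' by blast

lemma root_not_dsc: "j \<notin> dsc v"
proof
  assume "j \<in> dsc v"
  then obtain p where p: "apath j p j" "v \<in> set (pawalk_verts j p)" "j \<noteq> v" by (auto simp: dsc_def)
  moreover have "p = []"
    using apath_unique[OF p(1)] root_in_verts by (simp add: apath_Nil_iff)
  ultimately show False by simp
qed

text \<open>
  The path from u to the root is the path from its parent with u in front. This makes the descendant
  relation recursive along parents and lets later proofs go by induction up the tree.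
\<close>

lemma dsc_iff_pa:
  assumes "u \<in> pverts G" "u \<noteq> j"
  shows "u \<in> dsc v \<longleftrightarrow> pa u = v \<or> pa u \<in> dsc v"
proof -
  obtain p where p: "apath (pa u) p j" "apath u ((u, pa u) # p) j" "u \<notin> set (pawalk_verts (pa u) p)"
    using apath_to_root_parent[OF assms] by metis
  have "u \<in> dsc v \<longleftrightarrow> u \<noteq> v \<and> v \<in> set (pawalk_verts u ((u, pa u) # p))"
    using on_apath_iff[OF p(2), of v] by (auto simp: dsc_def)
  also have "\<dots> \<longleftrightarrow> v \<in> set (pawalk_verts (pa u) p)" using p(3) by auto
  finally show ?thesis using on_apath_iff[OF p(1)] by simp
qed

lemma pa_induct [consumes 1, case_names root step]:
  assumes "u \<in> pverts G"
    and "P j"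
    and "\<And>u. u \<in> pverts G \<Longrightarrow> u \<noteq> j \<Longrightarrow> P (pa u) \<Longrightarrow> P u"
  shows "P u"
proof -
  obtain p where "apath u p j" using apath_to_root assms(1) .
  then show ?thesis
  proof (induction p arbitrary: u)
    case Nil
    then show ?case using assms(2) by (simp add: apath_Nil_iff)
  next
    case (Cons e p)
    have u: "u \<in> pverts G" "u \<noteq> j"
      using Cons.prems apath_nonempty_ends[OF Cons.prems] awalkI_apath awalk_hd_in_verts by auto
    obtain p' where "apath (pa u) p' j" "apath u ((u, pa u) # p') j"
      using apath_to_root_parent[OF u] by metis
    then show ?case using Cons.IH apath_unique[OF Cons.prems] assms(3) u by blast
  qed
qed

lemma dsc_root: "dsc j = pverts G - {j}"
proof -
  have "u = j \<or> u \<in> dsc j" if "u \<in> pverts G" for u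
    using that by (induction rule: pa_induct) (auto simp: dsc_iff_pa)
  then show ?thesis using dsc_in_verts root_not_dsc by blast
qed

lemma dscD: "u \<in> dsc v \<Longrightarrow> u \<in> pverts G \<and> u \<noteq> j"
  using dsc_in_verts root_not_dsc by blast

lemma not_dsc_self: "v \<notin> dsc v"
  by (simp add: dsc_def)

lemma parent_not_dsc_child: "c \<in> ch v \<Longrightarrow> v \<notin> dsc c"
  using dsc_child_psubset not_dsc_self by blast

lemma ch_iff: "u \<in> ch v \<longleftrightarrow> u \<in> pverts G \<and> u \<noteq> j \<and> pa u = v"
proof
  assume u: "u \<in> ch v"
  have "u \<in> dsc v" "(u, v) \<in> parcs G" using u arc_sym by (auto simp: ch_def)
  moreover have "v \<notin> ch u" using parent_not_dsc_child[OF u] by (simp add: ch_def)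
  ultimately show "u \<in> pverts G \<and> u \<noteq> j \<and> pa u = v"
    using dscD apath_to_root_parent by metis
next
  assume "u \<in> pverts G \<and> u \<noteq> j \<and> pa u = v"
  then show "u \<in> ch v" using dsc_iff_pa[of u v] arc_sym[OF pa_arc[of u]] by (auto simp: ch_def)
qed

lemma finite_ch: "finite (ch v)"
  using finite_dsc by (auto simp: ch_def)

text \<open>
  Climbing from a descendant of v towards the root, the last vertex before v is a child of v; together
  with disjointness below, this partitions the descendants into branches.
\<close>

lemma dsc_eq_Union_branches: "dsc v = (\<Union>c\<in>ch v. insert c (dsc c))"
proof
  show "(\<Union>c\<in>ch v. insert c (dsc c)) \<subseteq> dsc v"
    using dsc_child_psubset by (auto simp: ch_def)
  have "u \<in> dsc v \<longrightarrow> u \<in> (\<Union>c\<in>ch v. insert c (dsc c))" if "u \<in> pverts G" for u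
    using that
  proof (induction rule: pa_induct)
    case root
    then show ?case using root_not_dsc by simp
  next
    case (step u)
    then show ?case by (cases "pa u = v") (auto simp: dsc_iff_pa[OF step.hyps(1,2)] ch_iff)
  qed
  then show "dsc v \<subseteq> (\<Union>c\<in>ch v. insert c (dsc c))" using dscD by blast
qed

text \<open>
  No child of v lies below another one, since v would then be that child or lie below it. So a
  vertex common to two branches is not the top of either, and its parent is common to them as well;
  but climbing to the parent cannot go on for ever.
\<close>

lemma disjoint_branches: "disjoint_family_on (\<lambda>c. insert c (dsc c)) (ch v)"
proof -
  have nested: "c \<notin> dsc c'" if "c \<in> ch v" "c' \<in> ch v" for c c'
  proof -
    have c: "c \<in> pverts G" "c \<noteq> j" "pa c = v" using that(1) by (auto simp: ch_iff)
    have "c' \<in> dsc v" using that(2) by (simp add: ch_def)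
    then have "v \<noteq> c'" using not_dsc_self by blast
    then show ?thesis using dsc_iff_pa[OF c(1,2)] c(3) parent_not_dsc_child[OF that(2)] by simp
  qed
  have same: "c = c'" if "u \<in> pverts G" "c \<in> ch v" "c' \<in> ch v"
    "u \<in> insert c (dsc c)" "u \<in> insert c' (dsc c')" for u c c'
    using that
  proof (induction rule: pa_induct)
    case root
    then show ?case using root_not_dsc by auto
  next
    case (step u)
    then show ?case
      using nested[of c c'] nested[of c' c] dsc_iff_pa[OF step.hyps(1,2)] by (auto simp: ch_iff)
  qed
  have in_verts: "insert c (dsc c) \<subseteq> pverts G" if "c \<in> ch v" for c
    using that dsc_in_verts by (simp add: ch_iff)
  show ?thesis unfolding disjoint_family_on_def
  proof (intro ballI impI equals0I)
    fix c c' u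
    assume c: "c \<in> ch v" "c' \<in> ch v" "c \<noteq> c'"
      and u: "u \<in> insert c (dsc c) \<inter> insert c' (dsc c')"
    have "u \<in> pverts G" using in_verts[OF c(1)] u by blast
    then show False using same[OF _ c(1,2), of u] u c(3) by blast
  qed
qed

text \<open>
  Sums over the edges become sums over the non-root vertices, each vertex standing for the edge to its
  parent.
\<close>

lemma edges_eq_image_parent: "edges G = (\<lambda>u. {pa u, u}) ` dsc j"
proof
  show "edges G \<subseteq> (\<lambda>u. {pa u, u}) ` dsc j"
  proof
    fix e assume "e \<in> edges G"
    then obtain u v where e: "e = {u, v}" "(u, v) \<in> parcs G" by (auto simp: edges_def)
    have "u \<noteq> v" "u \<in> pverts G" "v \<in> pverts G"
      using pair_no_loops[OF e(2)] wellformed'[OF e(2)] by auto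
    have "u = pa v \<and> v \<noteq> j \<or> v = pa u \<and> u \<noteq> j"
    proof (cases "v \<in> ch u")
      case True
      then show ?thesis by (simp add: ch_iff)
    next
      case False
      have "u \<noteq> j"
        using False e(2) \<open>u \<noteq> v\<close> \<open>v \<in> pverts G\<close> by (auto simp: ch_def dsc_root)
      then show ?thesis
        using False e(2) \<open>u \<in> pverts G\<close> apath_to_root_parent by metis
    qed
    then show "e \<in> (\<lambda>u. {pa u, u}) ` dsc j"
      using e \<open>u \<in> pverts G\<close> \<open>v \<in> pverts G\<close> by (auto simp: dsc_root)
  qed
  show "(\<lambda>u. {pa u, u}) ` dsc j \<subseteq> edges G"
    using pa_arc arc_sym by (fastforce simp: edges_def dsc_root)
qed

lemma inj_on_parent_edge: "inj_on (\<lambda>u. {pa u, u}) (dsc j)"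
proof (rule inj_onI)
  fix u v assume uv: "u \<in> dsc j" "v \<in> dsc j" "{pa u, u} = {pa v, v}"
  show "u = v"
  proof (rule ccontr)
    assume "u \<noteq> v"
    then have "pa u = v" "pa v = u" using uv(3) by (auto simp: doubleton_eq_iff)
    then have "u \<in> ch v" "v \<in> ch u" using uv dscD by (auto simp: ch_iff)
    then show False using parent_not_dsc_child[of u v] by (simp add: ch_def)
  qed
qed

end

section \<open>Partition functions of branches\<close>

context rooted_tree
begin

text \<open>
  Each non-root vertex takes charge of its own parameter and of that of the edge to its parent, so that
  the Ising weight is a product over vertices.
\<close>

definition factor :: "('v \<Rightarrow> real) \<Rightarrow> ('v set \<Rightarrow> real) \<Rightarrow> ('v \<Rightarrow> nat) \<Rightarrow> 'v \<Rightarrow> real" where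
  "factor \<eta> \<eta>' x u = exp (\<eta> u * real (x u) + \<eta>' {pa u, u} * (real (x u) * real (x (pa u))))"

text \<open>
  Two kinds of partition function, with a weight \<open>t u\<close> for every one: over the strict descendants
  of v when v has the value b, and over the branch at c when the parent of c has the value a. The
  boundary value enters through an update of the configuration at a vertex outside the summed region.
\<close>

definition below ::
  "('v \<Rightarrow> real) \<Rightarrow> ('v set \<Rightarrow> real) \<Rightarrow> ('v \<Rightarrow> real) \<Rightarrow> 'v \<Rightarrow> nat \<Rightarrow> real" where
  "below \<eta> \<eta>' t v b =
     (\<Sum>x\<in>dsc v \<rightarrow>\<^sub>E {0, 1}. \<Prod>u\<in>dsc v. t u ^ x u * factor \<eta> \<eta>' (x(v := b)) u)"

definition branch ::
  "('v \<Rightarrow> real) \<Rightarrow> ('v set \<Rightarrow> real) \<Rightarrow> ('v \<Rightarrow> real) \<Rightarrow> 'v \<Rightarrow> nat \<Rightarrow> real" where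
  "branch \<eta> \<eta>' t c a =
     (\<Sum>x\<in>insert c (dsc c) \<rightarrow>\<^sub>E {0, 1}.
       \<Prod>u\<in>insert c (dsc c). t u ^ x u * factor \<eta> \<eta>' (x(pa c := a)) u)"

lemma factor_cong: "x u = y u \<Longrightarrow> x (pa u) = y (pa u) \<Longrightarrow> factor \<eta> \<eta>' x u = factor \<eta> \<eta>' y u"
  by (simp add: factor_def)

lemma pa_not_in_branch:
  assumes "c \<in> dsc j"
  shows "pa c \<noteq> c" "pa c \<notin> dsc c"
proof -
  have "c \<in> ch (pa c)" using dscD[OF assms] by (simp add: ch_iff)
  then show "pa c \<notin> dsc c" using parent_not_dsc_child by simp
  show "pa c \<noteq> c"
    using \<open>c \<in> ch (pa c)\<close> not_dsc_self[of c] by (auto simp: ch_def)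
qed

lemma pa_dsc: "u \<in> dsc v \<Longrightarrow> pa u = v \<or> pa u \<in> dsc v"
  using dsc_iff_pa[of u v] dscD[of u v] by simp

lemma branch_eq:
  assumes "c \<in> dsc j"
  shows "branch \<eta> \<eta>' t c a =
    (\<Sum>b\<in>{0, 1}. t c ^ b * exp (\<eta> c * real b + \<eta>' {pa c, c} * (real b * real a)) * below \<eta> \<eta>' t c b)"
  unfolding branch_def below_def sum_PiE_insert[OF not_dsc_self] sum_distrib_left
proof (intro sum.cong refl)
  fix b and x :: "'v \<Rightarrow> nat"
  have "(\<Prod>u\<in>dsc c. t u ^ (x(c := b)) u * factor \<eta> \<eta>' (x(c := b, pa c := a)) u)
      = (\<Prod>u\<in>dsc c. t u ^ x u * factor \<eta> \<eta>' (x(c := b)) u)"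
  proof (intro prod.cong refl)
    fix u assume u: "u \<in> dsc c"
    have "u \<noteq> c" "u \<noteq> pa c" using u not_dsc_self pa_not_in_branch[OF assms] by blast+
    moreover have "pa u \<noteq> pa c" using pa_dsc[OF u] pa_not_in_branch[OF assms] by metis
    ultimately show "t u ^ (x(c := b)) u * factor \<eta> \<eta>' (x(c := b, pa c := a)) u
        = t u ^ x u * factor \<eta> \<eta>' (x(c := b)) u"
      by (simp add: factor_def)
  qed
  moreover have "factor \<eta> \<eta>' (x(c := b, pa c := a)) c
      = exp (\<eta> c * real b + \<eta>' {pa c, c} * (real b * real a))"
    using pa_not_in_branch[OF assms] by (simp add: factor_def)
  ultimately show "(\<Prod>u\<in>insert c (dsc c). t u ^ (x(c := b)) u * factor \<eta> \<eta>' (x(c := b, pa c := a)) u)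
      = t c ^ b * exp (\<eta> c * real b + \<eta>' {pa c, c} * (real b * real a))
        * (\<Prod>u\<in>dsc c. t u ^ x u * factor \<eta> \<eta>' (x(c := b)) u)"
    by (simp only: prod.insert[OF finite_dsc not_dsc_self] fun_upd_same)
qed

text \<open>Once the value at v is fixed, the branches at its children no longer interact.\<close>

lemma below_eq: "below \<eta> \<eta>' t v b = (\<Prod>c\<in>ch v. branch \<eta> \<eta>' t c b)"
proof -
  let ?S = "\<lambda>c. insert c (dsc c)"
  let ?f = "\<lambda>c x. \<Prod>u\<in>?S c. t u ^ x u * factor \<eta> \<eta>' (x(v := b)) u"
  have "(\<Prod>u\<in>(\<Union>c\<in>ch v. ?S c). t u ^ x u * factor \<eta> \<eta>' (x(v := b)) u) = (\<Prod>c\<in>ch v. ?f c x)" for x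
  proof (rule prod.UNION_disjoint[OF finite_ch])
    show "\<forall>c\<in>ch v. finite (?S c)" by (simp add: finite_dsc)
    show "\<forall>c\<in>ch v. \<forall>c'\<in>ch v. c \<noteq> c' \<longrightarrow> ?S c \<inter> ?S c' = {}"
      using disjoint_branches unfolding disjoint_family_on_def .
  qed
  then have "below \<eta> \<eta>' t v b = (\<Sum>x\<in>PiE (\<Union>c\<in>ch v. ?S c) (\<lambda>_. {0, 1}). \<Prod>c\<in>ch v. ?f c x)"
    unfolding below_def by (simp add: dsc_eq_Union_branches[of v] del: UN_insert_distrib)
  also have "\<dots> = (\<Prod>c\<in>ch v. \<Sum>x\<in>?S c \<rightarrow>\<^sub>E {0, 1}. ?f c x)"
  proof (rule sum_PiE_prod_disjoint[OF finite_ch disjoint_branches])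
    fix c and x y :: "'v \<Rightarrow> nat"
    assume c: "c \<in> ch v" and eq: "\<And>u. u \<in> ?S c \<Longrightarrow> x u = y u"
    have pa: "pa u = v \<or> pa u \<in> ?S c" if "u \<in> ?S c" for u
      using that pa_dsc c by (auto simp: ch_iff)
    show "?f c x = ?f c y"
    proof (intro prod.cong refl arg_cong2[of _ _ _ _ "(*)"] factor_cong)
      fix u assume u: "u \<in> ?S c"
      show "t u ^ x u = t u ^ y u" using eq[OF u] by simp
      show "(x(v := b)) u = (y(v := b)) u" using eq[OF u] by simp
      show "(x(v := b)) (pa u) = (y(v := b)) (pa u)" using pa[OF u] eq[of "pa u"] by auto
    qed
  qed
  also have "\<dots> = (\<Prod>c\<in>ch v. branch \<eta> \<eta>' t c b)"
    by (intro prod.cong refl) (simp add: branch_def ch_iff)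
  finally show ?thesis .
qed

text \<open>In the Ising model, this is the conditional probability of a one at c, given the value a at its
  parent.\<close>

definition transition :: "('v \<Rightarrow> real) \<Rightarrow> ('v set \<Rightarrow> real) \<Rightarrow> 'v \<Rightarrow> nat \<Rightarrow> real" where
  "transition q \<alpha> c a =
     (if a = 0 then q c - \<alpha> {pa c, c} * sigma q (pa c) c / (1 - q (pa c))
      else q c + \<alpha> {pa c, c} * sigma q (pa c) c / q (pa c))"

text \<open>
  The functions zeta and xi are the partition functions of a branch, normalised by their values at
  \<open>t = 1\<close>, with a zero or a one at the parent. The hypothesis says that the unweighted partition
  functions reproduce the conditional law of c given its parent; with it, the recursion of the
  partition functions turns into the defining recursion of zeta and xi.
\<close>

lemma branch_eq_zeta_xi:
  assumes transition: "\<And>c a b. c \<in> dsc j \<Longrightarrow> a \<in> {0, 1} \<Longrightarrow> b \<in> {0, 1} \<Longrightarrow>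
      exp (\<eta> c * real b + \<eta>' {pa c, c} * (real b * real a)) * below \<eta> \<eta>' (\<lambda>_. 1) c b
      = branch \<eta> \<eta>' (\<lambda>_. 1) c a * (if b = 0 then 1 - transition q \<alpha> c a else transition q \<alpha> c a)"
    and "c \<in> dsc j"
  shows "branch \<eta> \<eta>' t c 0 = branch \<eta> \<eta>' (\<lambda>_. 1) c 0 * zeta q \<alpha> t c
    \<and> branch \<eta> \<eta>' t c (Suc 0) = branch \<eta> \<eta>' (\<lambda>_. 1) c (Suc 0) * xi q \<alpha> t c"
  using assms(2)
proof (induction "card (dsc c)" arbitrary: c rule: less_induct)
  case less
  have IH: "branch \<eta> \<eta>' t i 0 = branch \<eta> \<eta>' (\<lambda>_. 1) i 0 * zeta q \<alpha> t i"
    "branch \<eta> \<eta>' t i (Suc 0) = branch \<eta> \<eta>' (\<lambda>_. 1) i (Suc 0) * xi q \<alpha> t i" if "i \<in> ch c" for i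
    using less.hyps[of i] psubset_card_mono[OF finite_dsc dsc_child_psubset[OF that]] that
    by (auto simp: ch_iff dsc_root)
  have below: "below \<eta> \<eta>' t c 0 = below \<eta> \<eta>' (\<lambda>_. 1) c 0 * (\<Prod>i\<in>ch c. zeta q \<alpha> t i)"
    "below \<eta> \<eta>' t c (Suc 0) = below \<eta> \<eta>' (\<lambda>_. 1) c (Suc 0) * (\<Prod>i\<in>ch c. xi q \<alpha> t i)"
    by (simp_all add: below_eq IH prod.distrib[symmetric])
  have "branch \<eta> \<eta>' t c a = branch \<eta> \<eta>' (\<lambda>_. 1) c a *
      ((1 - transition q \<alpha> c a) * (\<Prod>i\<in>ch c. zeta q \<alpha> t i)
        + transition q \<alpha> c a * t c * (\<Prod>i\<in>ch c. xi q \<alpha> t i))" if a: "a \<in> {0, 1}" for a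
  proof -
    let ?e = "\<lambda>b. exp (\<eta> c * real b + \<eta>' {pa c, c} * (real b * real a))"
    have "branch \<eta> \<eta>' t c a
        = (?e 0 * below \<eta> \<eta>' (\<lambda>_. 1) c 0) * (\<Prod>i\<in>ch c. zeta q \<alpha> t i)
          + t c * (?e 1 * below \<eta> \<eta>' (\<lambda>_. 1) c 1) * (\<Prod>i\<in>ch c. xi q \<alpha> t i)"
      by (simp add: branch_eq[OF less.prems, of _ _ t] below)
    then show ?thesis
      using transition[OF less.prems a, of 0] transition[OF less.prems a, of 1]
      by (simp only: insertCI if_True if_False one_neq_zero) (simp add: algebra_simps)
  qed
  from this[of 0] this[of 1] show ?case
    by (simp add: zeta.simps[of q \<alpha> t c] xi.simps[of q \<alpha> t c] transition_def diff_diff_eq)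
qed

section \<open>The Ising weight\<close>

definition weight :: "('v \<Rightarrow> real) \<Rightarrow> ('v set \<Rightarrow> real) \<Rightarrow> ('v \<Rightarrow> nat) \<Rightarrow> real" where
  "weight \<eta> \<eta>' x = exp (\<eta> j * real (x j)) * (\<Prod>u\<in>dsc j. factor \<eta> \<eta>' x u)"

lemma verts_eq: "pverts G = insert j (dsc j)"
  using root_in_verts by (auto simp: dsc_root)

lemma exp_ising_exponent: "exp (ising_exponent G \<eta> \<eta>' x) = weight \<eta> \<eta>' x"
proof -
  have "(\<Sum>e\<in>edges G. \<eta>' e * (\<Prod>v\<in>e. real (x v)))
      = (\<Sum>u\<in>dsc j. \<eta>' {pa u, u} * (real (x u) * real (x (pa u))))"
    unfolding edges_eq_image_parent sum.reindex[OF inj_on_parent_edge]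
    using pa_not_in_branch by (intro sum.cong) (auto simp: mult.commute)
  then have "ising_exponent G \<eta> \<eta>' x = \<eta> j * real (x j)
      + (\<Sum>u\<in>dsc j. \<eta> u * real (x u) + \<eta>' {pa u, u} * (real (x u) * real (x (pa u))))"
    using not_dsc_self finite_dsc by (simp add: ising_exponent_def verts_eq sum.distrib)
  then show ?thesis
    by (simp add: weight_def factor_def exp_add exp_sum finite_dsc)
qed

text \<open>The factor \<open>x j\<close> kills the configurations with a zero at the root, leaving \<open>b = 1\<close>.\<close>

lemma sum_weight_root:
  "(\<Sum>x\<in>pverts G \<rightarrow>\<^sub>E {0, 1}. real (x j) * (\<Prod>v\<in>pverts G. t v ^ x v) * weight \<eta> \<eta>' x)
    = t j * exp (\<eta> j) * below \<eta> \<eta>' t j 1"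
proof -
  have "(\<Prod>v\<in>dsc j. t v ^ (x(j := 1)) v) = (\<Prod>v\<in>dsc j. t v ^ x v)" for x
    using not_dsc_self[of j] by (intro prod.cong) auto
  then show ?thesis
    unfolding verts_eq sum_PiE_insert[OF not_dsc_self]
    using not_dsc_self finite_dsc
    by (simp add: weight_def below_def sum_distrib_left prod.distrib algebra_simps)
qed

text \<open>
  Cutting the edge above c leaves two components, and the weight couples them through that edge
  only; so the joint mass of c and its parent is a function of the parent times the mass that the
  branch at c contributes.
\<close>

lemma sum_weight_edge:
  assumes c: "c \<in> dsc j"
  obtains R where "\<And>a b. b \<in> {0, 1} \<Longrightarrow>
    (\<Sum>x\<in>pverts G \<rightarrow>\<^sub>E {0, 1}. of_bool (x (pa c) = a \<and> x c = b) * weight \<eta> \<eta>' x)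
    = R a * (exp (\<eta> c * real b + \<eta>' {pa c, c} * (real b * real a)) * below \<eta> \<eta>' (\<lambda>_. 1) c b)"
proof
  let ?S = "insert c (dsc c)"
  (* rest collects the factors outside the branch, R sums them with the value at the parent fixed *)
  define rest where "rest y = exp (\<eta> j * real (y j)) * (\<Prod>u\<in>dsc j - ?S. factor \<eta> \<eta>' y u)" for y
  define R where "R a = (\<Sum>y\<in>pverts G - ?S \<rightarrow>\<^sub>E {0, 1}. of_bool (y (pa c) = a) * rest y)" for a
  have sub: "?S \<subseteq> dsc j" using c dsc_in_verts root_not_dsc by (auto simp: dsc_root)
  then have V: "pverts G = (pverts G - ?S) \<union> ?S" by (auto simp: dsc_root)
  have pa_out: "pa u \<notin> ?S" if "u \<in> dsc j - ?S" for u
    using that dsc_iff_pa[of u c] dscD[of u j] by auto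
  have pa_c: "pa c \<notin> ?S" using pa_not_in_branch[OF c] by auto
  have rest: "rest (override_on y z ?S) = rest y" for y z
  proof -
    have "(\<Prod>u\<in>dsc j - ?S. factor \<eta> \<eta>' (override_on y z ?S) u) = (\<Prod>u\<in>dsc j - ?S. factor \<eta> \<eta>' y u)"
      using pa_out by (intro prod.cong refl factor_cong) (auto simp: override_on_def)
    moreover have "override_on y z ?S j = y j" using sub root_not_dsc by (auto simp: override_on_def)
    ultimately show ?thesis by (simp add: rest_def)
  qed
  fix a b :: nat assume b: "b \<in> {0, 1}"
  let ?e = "exp (\<eta> c * real b + \<eta>' {pa c, c} * (real b * real a))"
  have weight_split: "weight \<eta> \<eta>' (override_on y (z(c := b)) ?S)
      = rest y * (?e * (\<Prod>u\<in>dsc c. factor \<eta> \<eta>' (z(c := b)) u))" if "y (pa c) = a" for y z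
  proof -
    let ?x = "override_on y (z(c := b)) ?S"
    have "weight \<eta> \<eta>' ?x = rest ?x * (\<Prod>u\<in>?S. factor \<eta> \<eta>' ?x u)"
      unfolding weight_def rest_def
      using prod.subset_diff[OF sub finite_dsc, of "factor \<eta> \<eta>' ?x"] by simp
    also have "(\<Prod>u\<in>?S. factor \<eta> \<eta>' ?x u) = factor \<eta> \<eta>' ?x c * (\<Prod>u\<in>dsc c. factor \<eta> \<eta>' ?x u)"
      using finite_dsc not_dsc_self by simp
    also have "factor \<eta> \<eta>' ?x c = ?e"
      using pa_c that by (simp add: factor_def override_on_def)
    also have "(\<Prod>u\<in>dsc c. factor \<eta> \<eta>' ?x u) = (\<Prod>u\<in>dsc c. factor \<eta> \<eta>' (z(c := b)) u)"
      using pa_dsc[of _ c] by (intro prod.cong refl factor_cong) (auto simp: override_on_def)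
    finally show ?thesis unfolding rest .
  qed
  have other: "of_bool (override_on y (z(c := b')) ?S (pa c) = a \<and> override_on y (z(c := b')) ?S c = b)
      = (of_bool (y (pa c) = a) * of_bool (b' = b) :: real)" for y z b'
    using pa_c by (simp add: override_on_def)
  have "(\<Sum>x\<in>pverts G \<rightarrow>\<^sub>E {0, 1}. of_bool (x (pa c) = a \<and> x c = b) * weight \<eta> \<eta>' x)
      = (\<Sum>y\<in>pverts G - ?S \<rightarrow>\<^sub>E {0, 1}. \<Sum>b'\<in>{0, 1}. \<Sum>z\<in>dsc c \<rightarrow>\<^sub>E {0, 1}.
          of_bool (y (pa c) = a) * of_bool (b' = b) * weight \<eta> \<eta>' (override_on y (z(c := b')) ?S))"
    by (subst V, subst sum_PiE_Un) (simp_all only: sum_PiE_insert[OF not_dsc_self] other, blast)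
  also have "\<dots> = (\<Sum>y\<in>pverts G - ?S \<rightarrow>\<^sub>E {0, 1}. \<Sum>z\<in>dsc c \<rightarrow>\<^sub>E {0, 1}.
          of_bool (y (pa c) = a) * weight \<eta> \<eta>' (override_on y (z(c := b)) ?S))"
    using b by (intro sum.cong refl) auto
  also have "\<dots> = (\<Sum>y\<in>pverts G - ?S \<rightarrow>\<^sub>E {0, 1}. \<Sum>z\<in>dsc c \<rightarrow>\<^sub>E {0, 1}.
          of_bool (y (pa c) = a) * (rest y * (?e * (\<Prod>u\<in>dsc c. factor \<eta> \<eta>' (z(c := b)) u))))"
    by (intro sum.cong refl) (simp add: weight_split del: fun_upd_apply)
  also have "\<dots> = R a * (?e * below \<eta> \<eta>' (\<lambda>_. 1) c b)"
  proof -
    have "?e * below \<eta> \<eta>' (\<lambda>_. 1) c b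
        = (\<Sum>z\<in>dsc c \<rightarrow>\<^sub>E {0, 1}. ?e * (\<Prod>u\<in>dsc c. factor \<eta> \<eta>' (z(c := b)) u))"
      by (simp only: below_def sum_distrib_left power_one mult_1)
    then show ?thesis by (simp only: R_def sum_product mult.assoc)
  qed
  finally show "(\<Sum>x\<in>pverts G \<rightarrow>\<^sub>E {0, 1}. of_bool (x (pa c) = a \<and> x c = b) * weight \<eta> \<eta>' x)
    = R a * (?e * below \<eta> \<eta>' (\<lambda>_. 1) c b)" .
qed

end

section \<open>Moments determine the transition probabilities\<close>

context rooted_tree
begin

text \<open>
  With p the parent of c, the four masses of the pair (p, c) are fixed by the total mass, the two
  means and the mixed moment. Since each mass factorises over the edge, dividing by the marginal of p
  cancels the unknown factor that belongs to the rest of the tree. Here \<open>C * weight\<close> plays the role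
  of the probability mass function.
\<close>

lemma transition_from_moments:
  assumes c: "c \<in> dsc j"
    and "0 < q (pa c)" "q (pa c) < 1"
    and total: "(\<Sum>x\<in>pverts G \<rightarrow>\<^sub>E {0, 1}. C * weight \<eta> \<eta>' x) = 1"
    and mean_pa: "(\<Sum>x\<in>pverts G \<rightarrow>\<^sub>E {0, 1}. real (x (pa c)) * (C * weight \<eta> \<eta>' x)) = q (pa c)"
    and mean: "(\<Sum>x\<in>pverts G \<rightarrow>\<^sub>E {0, 1}. real (x c) * (C * weight \<eta> \<eta>' x)) = q c"
    and mixed: "(\<Sum>x\<in>pverts G \<rightarrow>\<^sub>E {0, 1}. real (x (pa c)) * real (x c) * (C * weight \<eta> \<eta>' x))
      = q (pa c) * q c + \<alpha> {pa c, c} * sigma q (pa c) c"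
    and a: "a \<in> {0, 1}" and b: "b \<in> {0, 1}"
  shows "exp (\<eta> c * real b + \<eta>' {pa c, c} * (real b * real a)) * below \<eta> \<eta>' (\<lambda>_. 1) c b
      = branch \<eta> \<eta>' (\<lambda>_. 1) c a * (if b = 0 then 1 - transition q \<alpha> c a else transition q \<alpha> c a)"
proof -
  define e where
    "e a b = exp (\<eta> c * real b + \<eta>' {pa c, c} * (real b * real a)) * below \<eta> \<eta>' (\<lambda>_. 1) c b" for a b
  define m where "m a b =
    (\<Sum>x\<in>pverts G \<rightarrow>\<^sub>E {0, 1}. of_bool (x (pa c) = a \<and> x c = b) * (C * weight \<eta> \<eta>' x))" for a b
  obtain R where "\<And>a b. b \<in> {0, 1} \<Longrightarrow>
      (\<Sum>x\<in>pverts G \<rightarrow>\<^sub>E {0, 1}. of_bool (x (pa c) = a \<and> x c = b) * weight \<eta> \<eta>' x) = R a * e a b"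
    unfolding e_def by (fact sum_weight_edge[OF c, of \<eta> \<eta>'])
  moreover have "m a b
      = C * (\<Sum>x\<in>pverts G \<rightarrow>\<^sub>E {0, 1}. of_bool (x (pa c) = a \<and> x c = b) * weight \<eta> \<eta>' x)" for a b
    by (simp only: m_def sum_distrib_left mult.left_commute)
  ultimately have m: "m a b = C * R a * e a b" if "b \<in> {0, 1}" for a b
    using that by simp
  have branch: "branch \<eta> \<eta>' (\<lambda>_. 1) c a = e a 0 + e a 1" for a
    by (simp add: branch_eq[OF c] e_def)
  have bits: "x (pa c) \<in> {0, 1}" "x c \<in> {0, 1}" if "x \<in> pverts G \<rightarrow>\<^sub>E {0, 1}" for x :: "'v \<Rightarrow> nat"
    using PiE_mem[OF that] dscD[OF c] pa_in_verts by auto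
  have sum_m: "m 0 0 + m 0 1 + m 1 0 + m 1 1 = 1"
    unfolding m_def total[symmetric] sum.distrib[symmetric]
  proof (intro sum.cong refl)
    fix x :: "'v \<Rightarrow> nat" assume "x \<in> pverts G \<rightarrow>\<^sub>E {0, 1}"
    from bits[OF this] show "of_bool (x (pa c) = 0 \<and> x c = 0) * (C * weight \<eta> \<eta>' x)
        + of_bool (x (pa c) = 0 \<and> x c = 1) * (C * weight \<eta> \<eta>' x)
        + of_bool (x (pa c) = 1 \<and> x c = 0) * (C * weight \<eta> \<eta>' x)
        + of_bool (x (pa c) = 1 \<and> x c = 1) * (C * weight \<eta> \<eta>' x)
        = C * weight \<eta> \<eta>' x" by auto
  qed
  have m_pa: "m 1 0 + m 1 1 = q (pa c)"
    unfolding m_def mean_pa[symmetric] sum.distrib[symmetric]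
  proof (intro sum.cong refl)
    fix x :: "'v \<Rightarrow> nat" assume "x \<in> pverts G \<rightarrow>\<^sub>E {0, 1}"
    from bits[OF this] show "of_bool (x (pa c) = 1 \<and> x c = 0) * (C * weight \<eta> \<eta>' x)
        + of_bool (x (pa c) = 1 \<and> x c = 1) * (C * weight \<eta> \<eta>' x)
        = real (x (pa c)) * (C * weight \<eta> \<eta>' x)" by auto
  qed
  have m_c: "m 0 1 + m 1 1 = q c"
    unfolding m_def mean[symmetric] sum.distrib[symmetric]
  proof (intro sum.cong refl)
    fix x :: "'v \<Rightarrow> nat" assume "x \<in> pverts G \<rightarrow>\<^sub>E {0, 1}"
    from bits[OF this] show "of_bool (x (pa c) = 0 \<and> x c = 1) * (C * weight \<eta> \<eta>' x)
        + of_bool (x (pa c) = 1 \<and> x c = 1) * (C * weight \<eta> \<eta>' x)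
        = real (x c) * (C * weight \<eta> \<eta>' x)" by auto
  qed
  have m_11: "m 1 1 = q (pa c) * q c + \<alpha> {pa c, c} * sigma q (pa c) c"
    unfolding m_def mixed[symmetric]
  proof (intro sum.cong refl)
    fix x :: "'v \<Rightarrow> nat" assume "x \<in> pverts G \<rightarrow>\<^sub>E {0, 1}"
    from bits[OF this] show "of_bool (x (pa c) = 1 \<and> x c = 1) * (C * weight \<eta> \<eta>' x)
        = real (x (pa c)) * real (x c) * (C * weight \<eta> \<eta>' x)" by auto
  qed
  have marginal: "C * R a * branch \<eta> \<eta>' (\<lambda>_. 1) c a = m a 0 + m a 1" for a
    by (simp add: branch m algebra_simps)
  have ratio: "m a 1 / (m a 0 + m a 1) = transition q \<alpha> c a \<and> m a 0 + m a 1 \<noteq> 0"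
  proof (cases "a = 0")
    case True
    have m0: "m 0 0 + m 0 1 = 1 - q (pa c)"
      "m 0 1 = q c * (1 - q (pa c)) - \<alpha> {pa c, c} * sigma q (pa c) c"
      using sum_m m_pa m_c m_11 by (simp_all add: algebra_simps)
    have "m 0 1 / (m 0 0 + m 0 1) = transition q \<alpha> c 0"
      unfolding m0(1) unfolding m0(2) using assms(3) by (simp add: transition_def diff_divide_distrib)
    moreover have "m 0 0 + m 0 1 \<noteq> 0" using m0(1) assms(3) by linarith
    ultimately show ?thesis unfolding True by blast
  next
    case False
    then have "a = 1" using a by simp
    have "m 1 1 / (m 1 0 + m 1 1) = transition q \<alpha> c 1"
      unfolding m_pa unfolding m_11 using assms(2) by (simp add: transition_def add_divide_distrib)
    moreover have "m 1 0 + m 1 1 \<noteq> 0" using m_pa assms(2) by linarith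
    ultimately show ?thesis unfolding \<open>a = 1\<close> by blast
  qed
  have "m a 0 / (m a 0 + m a 1) + m a 1 / (m a 0 + m a 1) = 1"
    unfolding add_divide_distrib[symmetric] by (rule divide_self[OF conjunct2[OF ratio]])
  then have "m a 0 / (m a 0 + m a 1) = 1 - transition q \<alpha> c a"
    unfolding conjunct1[OF ratio] by (simp only: eq_diff_eq)
  then have "m a b / (m a 0 + m a 1) = (if b = 0 then 1 - transition q \<alpha> c a else transition q \<alpha> c a)"
    using conjunct1[OF ratio] b by (elim insertE emptyE) (simp_all only: simp_thms if_True if_False one_neq_zero)
  moreover have "e a b * (m a 0 + m a 1) = branch \<eta> \<eta>' (\<lambda>_. 1) c a * m a b"
    using marginal[of a] m[OF b, of a] by (metis mult.assoc mult.commute)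
  then have "e a b = branch \<eta> \<eta>' (\<lambda>_. 1) c a * (m a b / (m a 0 + m a 1))"
    unfolding times_divide_eq_right nonzero_eq_divide_eq[OF conjunct2[OF ratio]] .
  ultimately show ?thesis unfolding e_def by (simp only:)
qed

text \<open>
  A one at the root makes every child see a one at its parent, so the sum is a constant times
  \<open>t j\<close> and the product of the branch partition functions at the children. At \<open>t = 1\<close> it equals the
  mean of the root, which identifies the constant; what remains of each branch is the ratio xi.
\<close>

lemma generating_function_root:
  assumes "\<And>v. v \<in> pverts G \<Longrightarrow> 0 < q v \<and> q v < 1"
    and total: "(\<Sum>x\<in>pverts G \<rightarrow>\<^sub>E {0, 1}. C * weight \<eta> \<eta>' x) = 1"
    and mean: "\<And>v. v \<in> pverts G \<Longrightarrow>
      (\<Sum>x\<in>pverts G \<rightarrow>\<^sub>E {0, 1}. real (x v) * (C * weight \<eta> \<eta>' x)) = q v"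
    and mixed: "\<And>u v. (u, v) \<in> parcs G \<Longrightarrow>
      (\<Sum>x\<in>pverts G \<rightarrow>\<^sub>E {0, 1}. real (x u) * real (x v) * (C * weight \<eta> \<eta>' x))
      = q u * q v + \<alpha> {u, v} * sigma q u v"
  shows "(\<Sum>x\<in>pverts G \<rightarrow>\<^sub>E {0, 1}. real (x j) * (\<Prod>v\<in>pverts G. t v ^ x v) * (C * weight \<eta> \<eta>' x))
    = q j * t j * (\<Prod>i\<in>ch j. xi q \<alpha> t i)"
proof -
  have root: "(\<Sum>x\<in>pverts G \<rightarrow>\<^sub>E {0, 1}. real (x j) * (\<Prod>v\<in>pverts G. t v ^ x v) * (C * weight \<eta> \<eta>' x))
      = C * (t j * exp (\<eta> j) * below \<eta> \<eta>' t j 1)" for t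
    unfolding sum_weight_root[symmetric] sum_distrib_left by (intro sum.cong) simp_all
  have qj: "q j = C * (exp (\<eta> j) * below \<eta> \<eta>' (\<lambda>_. 1) j 1)"
    using root[of "\<lambda>_. 1"] mean[OF root_in_verts] by simp
  have transition: "exp (\<eta> c * real b + \<eta>' {pa c, c} * (real b * real a)) * below \<eta> \<eta>' (\<lambda>_. 1) c b
      = branch \<eta> \<eta>' (\<lambda>_. 1) c a * (if b = 0 then 1 - transition q \<alpha> c a else transition q \<alpha> c a)"
    if "c \<in> dsc j" "a \<in> {0, 1}" "b \<in> {0, 1}" for c a b
  proof -
    have c: "c \<in> pverts G" "c \<noteq> j" using dscD[OF that(1)] by simp_all
    note pa = pa_in_verts[OF c]
    show ?thesis
      using that assms(1)[OF pa]
      by (intro transition_from_moments[where C = C] total mean[OF pa] mean[OF c(1)]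
          mixed[OF arc_sym[OF pa_arc[OF c]]]) auto
  qed
  have "below \<eta> \<eta>' t j 1 = below \<eta> \<eta>' (\<lambda>_. 1) j 1 * (\<Prod>i\<in>ch j. xi q \<alpha> t i)"
    unfolding below_eq prod.distrib[symmetric]
  proof (intro prod.cong refl)
    fix i assume "i \<in> ch j"
    then have "i \<in> dsc j" by (simp add: ch_def)
    have "branch \<eta> \<eta>' t i 0 = branch \<eta> \<eta>' (\<lambda>_. 1) i 0 * zeta q \<alpha> t i
      \<and> branch \<eta> \<eta>' t i (Suc 0) = branch \<eta> \<eta>' (\<lambda>_. 1) i (Suc 0) * xi q \<alpha> t i"
      by (rule branch_eq_zeta_xi) (fact transition \<open>i \<in> dsc j\<close>)+
    then show "branch \<eta> \<eta>' t i 1 = branch \<eta> \<eta>' (\<lambda>_. 1) i 1 * xi q \<alpha> t i" by simp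
  qed
  then show ?thesis unfolding root qj by (simp add: algebra_simps)
qed

end

section \<open>Expectations of Bernoulli vectors\<close>

context prob_space
begin

lemma expectation_bernoulli_vector:
  fixes J :: "'v \<Rightarrow> 'a \<Rightarrow> nat" and h :: "('v \<Rightarrow> nat) \<Rightarrow> real"
  assumes V: "finite V"
    and J: "\<And>v. v \<in> V \<Longrightarrow> random_variable (count_space {0, 1}) (J v)"
  shows "expectation (\<lambda>\<omega>. h (\<lambda>v\<in>V. J v \<omega>))
    = (\<Sum>x\<in>V \<rightarrow>\<^sub>E {0, 1}. h x * prob {\<omega> \<in> space M. \<forall>v\<in>V. J v \<omega> = x v})"
proof -
  let ?A = "\<lambda>x. {\<omega> \<in> space M. \<forall>v\<in>V. J v \<omega> = x v}"
  have fin: "finite (V \<rightarrow>\<^sub>E {0, 1 :: nat})" using V by (intro finite_PiE) auto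
  have bit: "J v \<omega> \<in> {0, 1}" if "v \<in> V" "\<omega> \<in> space M" for v \<omega>
    using measurable_space[OF J[OF that(1)] that(2)] by simp
  have A: "?A x \<in> events" if "x \<in> V \<rightarrow>\<^sub>E {0, 1}" for x
  proof (intro sets.sets_Collect_finite_All V)
    fix v assume v: "v \<in> V"
    have "J v -` {x v} \<inter> space M \<in> events"
      using measurable_sets[OF J[OF v], of "{x v}"] PiE_mem[OF that v] by simp
    moreover have "J v -` {x v} \<inter> space M = {\<omega> \<in> space M. J v \<omega> = x v}" by auto
    ultimately show "{\<omega> \<in> space M. J v \<omega> = x v} \<in> events" by simp
  qed
  have "expectation (\<lambda>\<omega>. h (\<lambda>v\<in>V. J v \<omega>))
      = expectation (\<lambda>\<omega>. \<Sum>x\<in>V \<rightarrow>\<^sub>E {0, 1}. h x * indicator (?A x) \<omega>)"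
  proof (intro Bochner_Integration.integral_cong refl)
    fix \<omega> assume \<omega>: "\<omega> \<in> space M"
    let ?x = "\<lambda>v\<in>V. J v \<omega>"
    have "?x \<in> V \<rightarrow>\<^sub>E {0, 1}" using bit \<omega> by simp
    moreover have "h x * indicator (?A x) \<omega> = (if ?x = x then h x else 0)"
      if "x \<in> V \<rightarrow>\<^sub>E {0, 1}" for x
    proof -
      have "?x = x \<longleftrightarrow> (\<forall>v\<in>V. J v \<omega> = x v)"
        using that by (auto simp: fun_eq_iff PiE_iff extensional_def)
      then show ?thesis using \<omega> by (simp add: indicator_def)
    qed
    ultimately show "h ?x = (\<Sum>x\<in>V \<rightarrow>\<^sub>E {0, 1}. h x * indicator (?A x) \<omega>)"
      using fin by (simp add: sum.delta')
  qed
  also have "\<dots> = (\<Sum>x\<in>V \<rightarrow>\<^sub>E {0, 1}. h x * prob (?A x))"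
    using A by (subst Bochner_Integration.integral_sum)
      (auto intro!: sum.cong integrable_mult_right integrable_real_indicator simp: emeasure_eq_measure)
  finally show ?thesis .
qed

text \<open>A variable with values 0 and 1 equals its own square, so its mean x determines its variance x (1 - x).\<close>

lemma mixed_moment_from_correlation:
  assumes X: "random_variable (count_space {0, 1}) (X :: 'a \<Rightarrow> nat)"
    and Y: "random_variable (count_space {0, 1}) (Y :: 'a \<Rightarrow> nat)"
    and x: "expectation (\<lambda>\<omega>. real (X \<omega>)) = x" "0 < x" "x < 1"
    and y: "expectation (\<lambda>\<omega>. real (Y \<omega>)) = y" "0 < y" "y < 1"
    and r: "correlation (\<lambda>\<omega>. real (X \<omega>)) (\<lambda>\<omega>. real (Y \<omega>)) = r"
  shows "expectation (\<lambda>\<omega>. real (X \<omega>) * real (Y \<omega>)) = x * y + r * sqrt (x * y * (1 - x) * (1 - y))"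
proof -
  have bit: "Z \<omega> \<in> {0, 1}" if "random_variable (count_space {0, 1}) Z" "\<omega> \<in> space M"
    for Z :: "'a \<Rightarrow> nat" and \<omega>
    using measurable_space[OF that] by simp
  have meas: "(\<lambda>\<omega>. real (Z \<omega>)) \<in> borel_measurable M" if "random_variable (count_space {0, 1}) Z"
    for Z :: "'a \<Rightarrow> nat"
    using measurable_compose[OF that, of real borel] by simp
  have int: "integrable M (\<lambda>\<omega>. real (Z \<omega>) * real (W \<omega>))"
    if Z: "random_variable (count_space {0, 1}) Z" and W: "random_variable (count_space {0, 1}) W"
    for Z W :: "'a \<Rightarrow> nat"
  proof (rule integrable_const_bound[where B = 1])
    show "AE \<omega> in M. norm (real (Z \<omega>) * real (W \<omega>)) \<le> 1"
    proof (rule AE_I2)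
      fix \<omega> assume "\<omega> \<in> space M"
      from bit[OF Z this] bit[OF W this] show "norm (real (Z \<omega>) * real (W \<omega>)) \<le> 1" by auto
    qed
  qed (intro borel_measurable_times meas Z W)
  have int1: "integrable M (\<lambda>\<omega>. real (Z \<omega>))"
    if Z: "random_variable (count_space {0, 1}) Z" for Z :: "'a \<Rightarrow> nat"
  proof (rule integrable_const_bound[where B = 1])
    show "AE \<omega> in M. norm (real (Z \<omega>)) \<le> 1"
    proof (rule AE_I2)
      fix \<omega> assume "\<omega> \<in> space M"
      from bit[OF Z this] show "norm (real (Z \<omega>)) \<le> 1" by auto
    qed
  qed (intro meas Z)
  have square: "expectation (\<lambda>\<omega>. real (Z \<omega>) * real (Z \<omega>)) = expectation (\<lambda>\<omega>. real (Z \<omega>))"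
    if Z: "random_variable (count_space {0, 1}) Z" for Z :: "'a \<Rightarrow> nat"
  proof (intro Bochner_Integration.integral_cong refl)
    fix \<omega> assume "\<omega> \<in> space M"
    from bit[OF Z this] show "real (Z \<omega>) * real (Z \<omega>) = real (Z \<omega>)" by auto
  qed
  have cov: "expectation (\<lambda>\<omega>. (real (Z \<omega>) - z) * (real (W \<omega>) - w))
      = expectation (\<lambda>\<omega>. real (Z \<omega>) * real (W \<omega>)) - z * w"
    if Z: "random_variable (count_space {0, 1}) Z" "expectation (\<lambda>\<omega>. real (Z \<omega>)) = z"
      and W: "random_variable (count_space {0, 1}) W" "expectation (\<lambda>\<omega>. real (W \<omega>)) = w"
    for Z W :: "'a \<Rightarrow> nat" and z w
    using int[OF Z(1) W(1)] int1[OF Z(1)] int1[OF W(1)] Z(2) W(2)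
    by (simp add: algebra_simps prob_space)
  have var: "variance (\<lambda>\<omega>. real (Z \<omega>)) = z * (1 - z)"
    if Z: "random_variable (count_space {0, 1}) Z" "expectation (\<lambda>\<omega>. real (Z \<omega>)) = z"
    for Z :: "'a \<Rightarrow> nat" and z
    using cov[OF Z Z] square[OF Z(1)] Z(2) by (simp add: power2_eq_square algebra_simps)
  have "r = (expectation (\<lambda>\<omega>. real (X \<omega>) * real (Y \<omega>)) - x * y)
      / sqrt (x * (1 - x) * (y * (1 - y)))"
    using r cov[OF X x(1) Y y(1)] var[OF X x(1)] var[OF Y y(1)] x(1) y(1)
    by (simp add: correlation_def)
  moreover have "x * (1 - x) * (y * (1 - y)) = x * y * (1 - x) * (1 - y)" by simp
  moreover have "sqrt (x * y * (1 - x) * (1 - y)) \<noteq> 0" using x y by simp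
  ultimately show ?thesis by (simp only: nonzero_eq_divide_eq) simp
qed

text \<open>The bound on K makes the power series a polynomial, which may be moved under the expectation.\<close>

lemma ogfea_eq_expectation:
  assumes "integrable M X"
    and K: "K \<in> measurable M (count_space UNIV)" "\<And>\<omega>. \<omega> \<in> space M \<Longrightarrow> K \<omega> \<le> d"
  shows "ogfea X K t = expectation (\<lambda>\<omega>. X \<omega> * t ^ K \<omega>)"
proof -
  let ?I = "\<lambda>k. indicator {\<omega> \<in> space M. K \<omega> = k} :: 'a \<Rightarrow> real"
  have ev: "{\<omega> \<in> space M. K \<omega> = k} \<in> events" for k
    using measurable_sets[OF K(1), of "{k}"] by (simp add: vimage_def Int_def conj_commute)
  have "expectation (\<lambda>\<omega>. X \<omega> * ?I k \<omega>) = 0" if "k \<notin> {..d}" for k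
  proof -
    have "expectation (\<lambda>\<omega>. X \<omega> * ?I k \<omega>) = expectation (\<lambda>\<omega>. 0)"
      using K(2) that by (intro Bochner_Integration.integral_cong) (auto simp: indicator_def)
    then show ?thesis by simp
  qed
  then have "ogfea X K t = (\<Sum>k\<le>d. t ^ k * expectation (\<lambda>\<omega>. X \<omega> * ?I k \<omega>))"
    unfolding ogfea_def by (intro suminf_finite) auto
  also have "\<dots> = expectation (\<lambda>\<omega>. \<Sum>k\<le>d. t ^ k * (X \<omega> * ?I k \<omega>))"
    using assms(1) ev by (subst Bochner_Integration.integral_sum)
      (auto intro!: integrable_mult_right integrable_real_mult_indicator)
  also have "\<dots> = expectation (\<lambda>\<omega>. X \<omega> * t ^ K \<omega>)"
  proof (intro Bochner_Integration.integral_cong refl)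
    fix \<omega> assume \<omega>: "\<omega> \<in> space M"
    have "(\<Sum>k\<le>d. t ^ k * (X \<omega> * ?I k \<omega>)) = (\<Sum>k\<le>d. if K \<omega> = k then X \<omega> * t ^ k else 0)"
      using \<omega> by (intro sum.cong) (auto simp: indicator_def)
    then show "(\<Sum>k\<le>d. t ^ k * (X \<omega> * ?I k \<omega>)) = X \<omega> * t ^ K \<omega>"
      using K(2)[OF \<omega>] by simp
  qed
  finally show ?thesis .
qed

end

section \<open>The generating function of the Ising model\<close>

text \<open>
  The identity holds for a vector of independent variables t; the generating function of expected
  allocations is its restriction to the diagonal.
\<close>

theorem (in prob_space) ising_generating_function:
  assumes "rooted_tree G j"
    and model: "ising_model G q \<alpha> J"
    and q: "\<And>v. v \<in> pverts G \<Longrightarrow> 0 < q v \<and> q v < 1"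
  shows "expectation (\<lambda>\<omega>. real (J j \<omega>) * (\<Prod>v\<in>pverts G. t v ^ J v \<omega>))
    = q j * t j * (\<Prod>i\<in>rooted_tree.ch G j j. rooted_tree.xi G j q \<alpha> t i)"
proof -
  interpret T: rooted_tree G j by fact
  note model' = model[unfolded ising_model_def]
  note J = bspec[OF conjunct1[OF model']]
  note mean = bspec[OF conjunct1[OF conjunct2[OF conjunct2[OF model']]]]
  have corr: "correlation (\<lambda>\<omega>. real (J u \<omega>)) (\<lambda>\<omega>. real (J v \<omega>)) = \<alpha> {u, v}"
    if "(u, v) \<in> parcs G" for u v
    using bspec[OF conjunct2[OF conjunct2[OF conjunct2[OF model']]] that] by simp
  obtain \<eta> \<eta>' where p: "prob {\<omega> \<in> space M. \<forall>v\<in>pverts G. J v \<omega> = x v}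
      = exp (ising_exponent G \<eta> \<eta>' x - log_partition G \<eta> \<eta>')"
    if "x \<in> pverts G \<rightarrow>\<^sub>E {0, 1}" for x
    using conjunct1[OF conjunct2[OF model']] by blast
  define C where "C = exp (- log_partition G \<eta> \<eta>')"
  have E: "expectation (\<lambda>\<omega>. h (\<lambda>v\<in>pverts G. J v \<omega>))
      = (\<Sum>x\<in>pverts G \<rightarrow>\<^sub>E {0, 1}. h x * (C * T.weight \<eta> \<eta>' x))" for h
  proof (subst expectation_bernoulli_vector[OF T.pair_finite_verts J], assumption, intro sum.cong refl)
    fix x :: "'b \<Rightarrow> nat" assume x: "x \<in> pverts G \<rightarrow>\<^sub>E {0, 1}"
    have "exp (ising_exponent G \<eta> \<eta>' x - log_partition G \<eta> \<eta>') = C * T.weight \<eta> \<eta>' x"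
      unfolding C_def T.exp_ising_exponent[symmetric] exp_add[symmetric] by simp
    then show "h x * prob {\<omega> \<in> space M. \<forall>v\<in>pverts G. J v \<omega> = x v} = h x * (C * T.weight \<eta> \<eta>' x)"
      unfolding p[OF x] by (rule arg_cong)
  qed
  have "(\<Sum>x\<in>pverts G \<rightarrow>\<^sub>E {0, 1}. real (x j) * (\<Prod>v\<in>pverts G. t v ^ x v) * (C * T.weight \<eta> \<eta>' x))
      = q j * t j * (\<Prod>i\<in>T.ch j. T.xi q \<alpha> t i)"
  proof (rule T.generating_function_root[OF q])
    show "(\<Sum>x\<in>pverts G \<rightarrow>\<^sub>E {0, 1}. C * T.weight \<eta> \<eta>' x) = 1"
      using E[of "\<lambda>_. 1"] by (simp add: prob_space)
    show "(\<Sum>x\<in>pverts G \<rightarrow>\<^sub>E {0, 1}. real (x v) * (C * T.weight \<eta> \<eta>' x)) = q v"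
      if "v \<in> pverts G" for v
      using E[of "\<lambda>x. real (x v)"] mean[OF that] that by simp
    show "(\<Sum>x\<in>pverts G \<rightarrow>\<^sub>E {0, 1}. real (x u) * real (x v) * (C * T.weight \<eta> \<eta>' x))
        = q u * q v + \<alpha> {u, v} * sigma q u v" if uv: "(u, v) \<in> parcs G" for u v
    proof -
      have V: "u \<in> pverts G" "v \<in> pverts G" using T.wellformed'[OF uv] by auto
      note qs = q[OF V(1)] q[OF V(2)]
      have "expectation (\<lambda>\<omega>. real (J u \<omega>) * real (J v \<omega>)) = q u * q v + \<alpha> {u, v} * sigma q u v"
        unfolding sigma_def
        using mixed_moment_from_correlation[OF J[OF V(1)] J[OF V(2)] mean[OF V(1)] _ _
            mean[OF V(2)] _ _ corr[OF uv]] qs by blast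
      then show ?thesis
        using E[of "\<lambda>x. real (x u) * real (x v)"] V by simp
    qed
  qed
  then show ?thesis
    using E[of "\<lambda>x. real (x j) * (\<Prod>v\<in>pverts G. t v ^ x v)"] T.root_in_verts by simp
qed

theorem proposition2:
  fixes d :: nat
    and G :: "nat pair_pre_digraph"
    and q :: "nat \<Rightarrow> real"
    and \<alpha> :: "nat set \<Rightarrow> real"
    and M :: "'a measure"
    and J :: "nat \<Rightarrow> 'a \<Rightarrow> nat"
    and K :: "'a \<Rightarrow> nat"
    and j :: nat
    and t :: real
  assumes "undirected_tree G"
    and "pverts G = {1..d}"
    and "\<forall>v\<in>{1..d}. 0 < q v \<and> q v < 1"
    and "\<alpha> \<in> Lambda G q"
    and "prob_space M"
    and "prob_space.ising_model M G q \<alpha> J"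
    and "K = (\<lambda>\<omega>. \<Sum>v\<in>{1..d}. J v \<omega>)"
    and "j \<in> {1..d}"
    and "-1 \<le> t" and "t \<le> 1"
  shows "prob_space.ogfea M (\<lambda>\<omega>. real (J j \<omega>)) K t
    = q j * t * (\<Prod>i\<in>rooted_tree.ch G j j. rooted_tree.xi G j q \<alpha> (\<lambda>_. t) i)"
proof -
  interpret T: rooted_tree G j
    using assms(1,2,8) by (auto simp: rooted_tree_def rooted_tree_axioms_def)
  interpret M: prob_space M by fact
  have J: "J v \<in> measurable M (count_space {0, 1})" if "v \<in> {1..d}" for v
    using assms(2,6) that by (simp add: M.ising_model_def)
  have bit: "J v \<omega> \<le> 1" if "v \<in> {1..d}" "\<omega> \<in> space M" for v \<omega>
    using measurable_space[OF J[OF that(1)] that(2)] by auto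
  have J_UNIV: "J v \<in> measurable M (count_space UNIV)" if "v \<in> {1..d}" for v
    using measurable_compose[OF J[OF that], of "\<lambda>x. x" "count_space UNIV"] by simp
  have "M.ogfea (\<lambda>\<omega>. real (J j \<omega>)) K t = M.expectation (\<lambda>\<omega>. real (J j \<omega>) * t ^ K \<omega>)"
  proof (rule M.ogfea_eq_expectation)
    show "integrable M (\<lambda>\<omega>. real (J j \<omega>))"
      using bit[OF assms(8)] measurable_compose[OF J_UNIV[OF assms(8)], of real borel]
      by (intro M.integrable_const_bound[where B = 1]) (auto intro!: AE_I2)
    show "K \<in> measurable M (count_space UNIV)"
      unfolding assms(7) using J_UNIV by (intro measurable_sum_nat) auto
    show "K \<omega> \<le> d" if "\<omega> \<in> space M" for \<omega>
      unfolding assms(7) using sum_bounded_above[of "{1..d}" "\<lambda>v. J v \<omega>" 1] bit that by simp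
  qed
  also have "\<dots> = M.expectation (\<lambda>\<omega>. real (J j \<omega>) * (\<Prod>v\<in>pverts G. t ^ J v \<omega>))"
    by (simp add: assms(2,7) power_sum)
  also have "\<dots> = q j * t * (\<Prod>i\<in>T.ch j. T.xi q \<alpha> (\<lambda>_. t) i)"
    using M.ising_generating_function[OF T.rooted_tree_axioms assms(6), of "\<lambda>_. t"] assms(2,3) by simp
  finally show ?thesis .
qed

end
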